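(* Let $X$ be a Priestley space. Then $(\mathsf{CC}(X),\unlhd)$ is a root system, i.e., $\unlhd$ is a partial order and for every $C\in\mathsf{CC}(X)$ the set $\{K\in\mathsf{CC}(X)\mid C\unlhd K\}$ is totally ordered by $\unlhd$.
   Context: A Priestley space is a compact space with a partial order such that $x\not\le y$ implies a clopen upset containing $x$ but not $y$. $\mathsf{CC}(X)$ is the set of nonempty closed chains (totally ordered closed subsets) of $X$, and $C_1\unlhd C_2$ iff $C_2\subseteq C_1$ and $C_2$ is an upset of $C_1$ (with respect to the order of $X$). *)

theory Defs
  imports "HOL-Analysis.Abstract_Topology"
begin

text \<open>The order of the space is a relation \<open>r\<close>, where \<open>(x, y) \<in> r\<close> means \<open>x \<le> y\<close>; the
  carrier is \<open>topspace X\<close>, which may be empty.\<close>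

definition upset_in :: "('a \<times> 'a) set \<Rightarrow> 'a set \<Rightarrow> 'a set \<Rightarrow> bool" where
  "upset_in r S U \<longleftrightarrow> U \<subseteq> S \<and> (\<forall>x\<in>U. \<forall>y\<in>S. (x, y) \<in> r \<longrightarrow> y \<in> U)"

definition priestley_space :: "'a topology \<Rightarrow> ('a \<times> 'a) set \<Rightarrow> bool" where
  "priestley_space X r \<longleftrightarrow>
     compact_space X \<and>
     partial_order_on (topspace X) r \<and>
     (\<forall>x\<in>topspace X. \<forall>y\<in>topspace X. (x, y) \<notin> r \<longrightarrow>
        (\<exists>U. openin X U \<and> closedin X U \<and> upset_in r (topspace X) U \<and> x \<in> U \<and> y \<notin> U))"

definition CC :: "'a topology \<Rightarrow> ('a \<times> 'a) set \<Rightarrow> 'a set set" where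
  "CC X r = {C. C \<noteq> {} \<and> closedin X C \<and> total_on C r}"

definition CC_order :: "'a topology \<Rightarrow> ('a \<times> 'a) set \<Rightarrow> ('a set \<times> 'a set) set" where
  "CC_order X r =
     {(C1, C2). C1 \<in> CC X r \<and> C2 \<in> CC X r \<and> C2 \<subseteq> C1 \<and> upset_in r C1 C2}"

text \<open>On subsets of \<open>A\<close>, totality already yields a total order, since \<open>R\<close> is a partial order.\<close>

definition root_system :: "'b set \<Rightarrow> ('b \<times> 'b) set \<Rightarrow> bool" where
  "root_system A R \<longleftrightarrow>
     partial_order_on A R \<and> (\<forall>c\<in>A. total_on {k \<in> A. (c, k) \<in> R} R)"

end

theory Submission
  imports Defs
begin

text \<open>Everything above a chain \<open>C\<close> is an upset of \<open>C\<close>, and two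
  upsets of one chain are comparable by inclusion (\<open>upset_in_chain_linear\<close>). The
  smaller is then also an upset of the larger (\<open>upset_in_subset\<close>), which is
  comparability in \<open>CC_order\<close>. That \<open>CC_order\<close> is a partial order follows
  from upsets of upsets being upsets and from antisymmetry of inclusion.\<close>

lemma upset_in_refl: "upset_in r S S"
  by (simp add: upset_in_def)

lemma upset_in_trans: "upset_in r S T \<Longrightarrow> upset_in r T U \<Longrightarrow> upset_in r S U"
  unfolding upset_in_def by blast

lemma upset_in_subset: "upset_in r S U \<Longrightarrow> U \<subseteq> T \<Longrightarrow> T \<subseteq> S \<Longrightarrow> upset_in r T U"
  unfolding upset_in_def by blast

lemma upset_in_chain_linear:
  assumes "total_on C r" "upset_in r C K" "upset_in r C L"
  shows "K \<subseteq> L \<or> L \<subseteq> K"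
proof (rule ccontr)
  assume "\<not> (K \<subseteq> L \<or> L \<subseteq> K)"
  then obtain x y where xy: "x \<in> K" "x \<notin> L" "y \<in> L" "y \<notin> K"
    by blast
  with assms(2,3) have "x \<in> C" "y \<in> C" "x \<noteq> y"
    by (auto simp: upset_in_def)
  with assms(1) have "(x, y) \<in> r \<or> (y, x) \<in> r"
    by (simp add: total_on_def)
  \<comment> \<open>If \<open>x\<close> lies below \<open>y\<close>, upward closure of
    \<open>K\<close> puts \<open>y\<close> in \<open>K\<close>; otherwise that of \<open>L\<close>
    puts \<open>x\<close> in \<open>L\<close>.\<close>
  with xy \<open>x \<in> C\<close> \<open>y \<in> C\<close> assms(2,3) show False
    by (auto simp: upset_in_def)
qed

lemma partial_order_on_CC_order: "partial_order_on (CC X r) (CC_order X r)"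
proof -
  have "CC_order X r \<subseteq> CC X r \<times> CC X r"
    by (auto simp: CC_order_def)
  moreover have "refl_on (CC X r) (CC_order X r)"
    by (auto simp: refl_on_def CC_order_def upset_in_refl)
  moreover have "trans (CC_order X r)"
    by (rule transI) (auto simp: CC_order_def intro: upset_in_trans)
  moreover have "antisym (CC_order X r)"
    by (rule antisymI) (auto simp: CC_order_def)
  ultimately show ?thesis
    by (simp add: partial_order_on_def preorder_on_def)
qed

text \<open>\<open>CC_order\<close> reverses inclusion: when \<open>L \<subseteq> K\<close>, the
  pair obtained is \<open>(K, L)\<close>, with \<open>upset_in_subset\<close> shrinking the ambient
  set from \<open>C\<close> to \<open>K\<close>.\<close>

lemma total_on_CC_order_above:
  "total_on {K \<in> CC X r. (C, K) \<in> CC_order X r} (CC_order X r)"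
proof (rule total_onI)
  fix K L
  assume "K \<in> {K \<in> CC X r. (C, K) \<in> CC_order X r}" "L \<in> {K \<in> CC X r. (C, K) \<in> CC_order X r}"
  then have *: "total_on C r" "K \<in> CC X r" "L \<in> CC X r" "K \<subseteq> C" "L \<subseteq> C"
      "upset_in r C K" "upset_in r C L"
    by (auto simp: CC_order_def CC_def)
  with upset_in_chain_linear[of C r K L] show "(K, L) \<in> CC_order X r \<or> (L, K) \<in> CC_order X r"
    by (auto simp: CC_order_def intro: upset_in_subset)
qed

theorem theorem3p8:
  fixes X :: "'a topology" and r :: "('a \<times> 'a) set"
  assumes "priestley_space X r"
  shows "root_system (CC X r) (CC_order X r)"
  by (simp add: root_system_def partial_order_on_CC_order total_on_CC_order_above)

end
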